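(* Let $C_n$ denote the cycle on $n$ vertices. For every $n \ge 4$, $$\iota_{\rm g}(C_n)=\begin{cases}2\left\lceil \frac{n}{5}\right\rceil, & \text{if } n\equiv 0 \pmod 5,\\[2pt] 2\left\lceil \frac{n}{5}\right\rceil-1, & \text{otherwise},\end{cases}$$ and $$\iota_{\rm g}'(C_n)=\begin{cases}2\left\lfloor \frac{n}{5}\right\rfloor+1, & \text{if } n\equiv 4 \pmod 5,\\[2pt] 2\left\lfloor \frac{n}{5}\right\rfloor, & \text{otherwise}.\end{cases}$$
   Context: For a graph $G$ and $X\subseteq V(G)$, $N_G[X]$ denotes the set of vertices in $X$ or adjacent to a vertex of $X$. The isolation game on a finite graph $G$ is played by two players, Dominator and Staller, who alternately select vertices of $G$. If $X$ is the set of vertices selected so far, a vertex $x$ may be selected (is playable) only if $x$ dominates (i.e., equals or is adjacent to) some vertex belonging to a component of $G - N_G[X]$ with at least two vertices. The game ends when no playable vertex exists. Dominator aims to minimize the total number of selected vertices, Staller aims to maximize it. The game isolation number $\iota_{\rm g}(G)$ is the number of vertices selected when Dominator makes the first move and both play optimally; $\iota_{\rm g}'(G)$ is the same quantity when Staller makes the first move. *)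

theory Defs
  imports Complex_Main "Graph_Theory.Graph_Theory"
begin

datatype player = Dominator | Staller

text \<open>
  The locale \<^locale>\<open>graph\<close> describes finite simple graphs: every edge is represented by a
  pair of opposite arcs, so the strongly connected components of (an induced subgraph of) such a
  graph are its connected components.
\<close>

context graph
begin

definition closed_nbhd :: "'a set \<Rightarrow> 'a set" where
  "closed_nbhd X = {v \<in> verts G. v \<in> X \<or> (\<exists>x\<in>X. x \<rightarrow>\<^bsub>G\<^esub> v)}"

definition residual :: "'a set \<Rightarrow> ('a, 'b) pre_digraph" where
  "residual X = G \<restriction> (verts G - closed_nbhd X)"

definition playable :: "'a set \<Rightarrow> 'a set" where
  "playable X = {x \<in> verts G. \<exists>K \<in> pre_digraph.sccs (residual X).
     card (verts K) \<ge> 2 \<and> (\<exists>v \<in> verts K. v = x \<or> x \<rightarrow>\<^bsub>G\<^esub> v)}"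

lemma playable_subset_verts: "playable X \<subseteq> verts G"
  by (auto simp: playable_def)

lemma finite_playable [simp]: "finite (playable X)"
  using playable_subset_verts finite_verts by (rule finite_subset)

lemma playable_not_selected:
  assumes "x \<in> playable X"
  shows "x \<notin> X"
proof
  assume "x \<in> X"
  from assms obtain K v where K: "K \<in> pre_digraph.sccs (residual X)"
    and v: "v \<in> verts K" "v = x \<or> x \<rightarrow>\<^bsub>G\<^esub> v"
    by (auto simp: playable_def)
  from K have "induced_subgraph K (residual X)"
    by (rule pre_digraph.in_sccs_imp_induced)
  then have "verts K \<subseteq> verts G - closed_nbhd X"
    by (auto simp: induced_subgraph_def subgraph_def residual_def)
  with v \<open>x \<in> X\<close> show False
    by (auto simp: closed_nbhd_def)
qed

text \<open>
  The number of vertices still to be selected under optimal play, when the vertices in the given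
  set have already been selected and the given player moves next.
\<close>

function remaining_moves :: "player \<Rightarrow> 'a set \<Rightarrow> nat" where
  "remaining_moves Dominator X =
     (if playable X = {} then 0
      else Min ((\<lambda>x. Suc (remaining_moves Staller (insert x X))) ` playable X))"
| "remaining_moves Staller X =
     (if playable X = {} then 0
      else Max ((\<lambda>x. Suc (remaining_moves Dominator (insert x X))) ` playable X))"
  by pat_completeness auto
termination
proof (relation "measure (\<lambda>(_, X). card (verts G - X))")
  have "card (verts G - insert x X) < card (verts G - X)" if "x \<in> playable X" for x X
    using that playable_subset_verts playable_not_selected[OF that]
    by (intro psubset_card_mono) auto
  then show "x \<in> playable X \<Longrightarrow>
      ((Staller, insert x X), (Dominator, X)) \<in> measure (\<lambda>(_, X). card (verts G - X))"
    and "x \<in> playable X \<Longrightarrow>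
      ((Dominator, insert x X), (Staller, X)) \<in> measure (\<lambda>(_, X). card (verts G - X))" for x X
    by auto
qed auto

declare remaining_moves.simps [simp del]

definition game_isolation_number :: nat  (\<open>\<iota>\<^sub>g\<close>) where
  "game_isolation_number = remaining_moves Dominator {}"

definition staller_game_isolation_number :: nat  (\<open>\<iota>\<^sub>g''\<close>) where
  "staller_game_isolation_number = remaining_moves Staller {}"

end

definition cycle_graph :: "nat \<Rightarrow> nat pair_pre_digraph" where
  "cycle_graph n = \<lparr> pverts = {0..<n},
     parcs = {(i, j). i < n \<and> j < n \<and> (j = (i + 1) mod n \<or> i = (j + 1) mod n)} \<rparr>"

lemma pair_graph_cycle_graph:
  assumes "n \<ge> 3"
  shows "pair_graph (cycle_graph n)"
proof
  have "parcs (cycle_graph n) \<subseteq> {0..<n} \<times> {0..<n}"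
    by (auto simp: cycle_graph_def)
  then show "finite (parcs (cycle_graph n))"
    by (rule finite_subset) simp
  have ne: "(i + 1) mod n \<noteq> i" if "i < n" for i
    using assms that by (cases "i + 1 = n") auto
  show "fst e \<noteq> snd e" if "e \<in> parcs (cycle_graph n)" for e
    using that ne by (auto simp: cycle_graph_def) metis+
qed (auto simp: cycle_graph_def symmetric_def sym_def)

lemma graph_cycle_graph: "n \<ge> 3 \<Longrightarrow> graph (with_proj (cycle_graph n))"
  by (rule pair_graph.pair_graphD_graph) (rule pair_graph_cycle_graph)

end

theory Submission
  imports Defs
begin

text \<open>
  After the first move the selected vertices cut the cycle into gaps, that is, distances between
  cyclically consecutive selected vertices. The interior of a gap of length \<open>d\<close> contains a path of
  \<open>d - 3\<close> undominated vertices, so a move replaces some gap \<open>d \<ge> 5\<close> by two gaps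
  \<open>j\<close> and \<open>d - j\<close> with \<open>0 < j < d\<close>, and every such replacement is legal.

  Let \<open>D\<close> and \<open>S\<close> be the number of remaining moves when Dominator, respectively Staller, is to
  move. Two additive potentials \<open>W\<close> and \<open>U\<close>, which depend on \<open>(d - 4) div 5\<close> and
  the residue \<open>(d - 4) mod 5\<close> of each gap, control these numbers. Staller, shortening a gap by one, keeps
  \<open>W \<le> 4 D + 3\<close> and \<open>W \<le> 4 S\<close>, with \<open>W + 1 \<le> 4 S\<close> if a gap with residue 4 exists. Dominator,
  splitting off a gap of length 4, keeps \<open>D \<le> U\<close> and \<open>S \<le> U\<close>, with \<open>D + 1 \<le> U\<close> if a gap
  with residue at least 2 exists. For the single gap \<open>n\<close> these bounds coincide.
\<close>

section \<open>The game on a graph\<close>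

context graph
begin

text \<open>Eliminates components: a vertex of the residual graph lies in a component with at least
  two vertices exactly when it has a neighbour there. A legal move is thus one that dominates an end
  of an undominated edge.\<close>

lemma playable_iff:
  "x \<in> playable X \<longleftrightarrow> x \<in> verts G \<and>
     (\<exists>v w. v \<in> verts G - closed_nbhd X \<and> w \<in> verts G - closed_nbhd X \<and>
        v \<rightarrow>\<^bsub>G\<^esub> w \<and> (v = x \<or> x \<rightarrow>\<^bsub>G\<^esub> v))"
proof -
  let ?R = "verts G - closed_nbhd X"
  interpret H: wf_digraph "residual X"
    unfolding residual_def by (rule wellformed_induce_subgraph)
  have adj: "v \<rightarrow>\<^bsub>residual X\<^esub> w \<longleftrightarrow> v \<in> ?R \<and> w \<in> ?R \<and> v \<rightarrow>\<^bsub>G\<^esub> w" for v w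
    by (auto simp: residual_def induce_subgraph_def arcs_ends_conv)
  have sym: "w \<rightarrow>\<^bsub>G\<^esub> v" if "v \<rightarrow>\<^bsub>G\<^esub> w" for v w
    using that by (rule graph_symmetric)
  have nontriv: "(\<exists>S\<in>H.sccs_verts. card S \<ge> 2 \<and> v \<in> S) \<longleftrightarrow> (\<exists>w. v \<rightarrow>\<^bsub>residual X\<^esub> w)" for v
  proof
    assume "\<exists>S\<in>H.sccs_verts. card S \<ge> 2 \<and> v \<in> S"
    then obtain S where S: "S \<in> H.sccs_verts" "card S \<ge> 2" "v \<in> S" by blast
    then have "\<not> S \<subseteq> {v}" by (auto simp: subset_singleton_iff)
    then obtain u where "u \<in> S" "u \<noteq> v" by blast
    with S have "v \<rightarrow>\<^sup>*\<^bsub>residual X\<^esub> u"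
      by (auto simp: H.in_sccs_verts_conv_reachable)
    with \<open>u \<noteq> v\<close> show "\<exists>w. v \<rightarrow>\<^bsub>residual X\<^esub> w"
      by (auto elim: H.converse_reachable_cases)
  next
    assume "\<exists>w. v \<rightarrow>\<^bsub>residual X\<^esub> w"
    then obtain w where vw: "v \<rightarrow>\<^bsub>residual X\<^esub> w" by blast
    then have wv: "w \<rightarrow>\<^bsub>residual X\<^esub> v" and "v \<noteq> w"
      using sym adj_not_same by (auto simp: adj)
    have v: "v \<in> verts (residual X)" using vw unfolding adj by (simp add: residual_def)
    have "{v, w} \<subseteq> H.scc_of v"
      using vw wv v by (auto simp: H.scc_of_def)
    moreover have "H.scc_of v \<in> H.sccs_verts"
      using v by (rule H.scc_of_in_sccs_verts)
    moreover have "finite (H.scc_of v)"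
    proof (rule finite_subset)
      show "H.scc_of v \<subseteq> verts (residual X)"
        by (auto simp: H.scc_of_def dest: H.reachable_in_verts)
    qed (simp add: residual_def)
    ultimately show "\<exists>S\<in>H.sccs_verts. card S \<ge> 2 \<and> v \<in> S"
      using \<open>v \<noteq> w\<close> by (metis card_2_iff card_mono insert_subset)
  qed
  have "x \<in> playable X \<longleftrightarrow> x \<in> verts G \<and>
    (\<exists>v. (\<exists>S\<in>H.sccs_verts. card S \<ge> 2 \<and> v \<in> S) \<and> (v = x \<or> x \<rightarrow>\<^bsub>G\<^esub> v))"
    unfolding playable_def H.sccs_verts_conv by blast
  then show ?thesis
    unfolding nontriv adj by blast
qed

text \<open>Of the four one-sided bounds on the recursion, those in favour of the player to move
  need one exhibited move, and the other two need a check of every legal move.\<close>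

lemma remaining_moves_Dominator_le:
  assumes "y \<in> playable X" "remaining_moves Staller (insert y X) \<le> k"
  shows "remaining_moves Dominator X \<le> Suc k"
  using assms by (subst remaining_moves.simps) (auto intro!: Min.coboundedI[THEN order_trans])

lemma remaining_moves_Dominator_ge:
  assumes "playable X \<noteq> {}" "\<And>y. y \<in> playable X \<Longrightarrow> k \<le> remaining_moves Staller (insert y X)"
  shows "Suc k \<le> remaining_moves Dominator X"
  using assms by (subst remaining_moves.simps) auto

lemma remaining_moves_Staller_ge:
  assumes "y \<in> playable X" "k \<le> remaining_moves Dominator (insert y X)"
  shows "Suc k \<le> remaining_moves Staller X"
proof -
  have "Suc k \<le> Suc (remaining_moves Dominator (insert y X))" using assms(2) by simp
  also have "\<dots> \<le> Max ((\<lambda>x. Suc (remaining_moves Dominator (insert x X))) ` playable X)"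
    using assms(1) by (intro Max_ge) auto
  also have "\<dots> = remaining_moves Staller X"
    using assms(1) by (auto simp: remaining_moves.simps(2)[of X])
  finally show ?thesis .
qed

lemma remaining_moves_Staller_le:
  assumes "playable X \<noteq> {}" "\<And>y. y \<in> playable X \<Longrightarrow> remaining_moves Dominator (insert y X) \<le> k"
  shows "remaining_moves Staller X \<le> Suc k"
  using assms by (subst remaining_moves.simps) auto

lemma remaining_moves_eq_0: "playable X = {} \<Longrightarrow> remaining_moves p X = 0"
  by (cases p) (auto simp: remaining_moves.simps)

end

section \<open>Potentials of gaps\<close>

text \<open>
  The lower weight is four times the mean value of a gap, in the sense of sums of switches; for
  residue 4 the mean 15/8 is rounded down to 7/4. The upper weight counts every residue from 2 on as
  if Staller had already profited from it. Truncated subtraction gives gaps shorter than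
  four, all of whose vertices are dominated, the weight 0.
\<close>

definition lower_weight :: "nat \<Rightarrow> nat" where
  "lower_weight d = 8 * ((d - 4) div 5) + [0, 4, 6, 7, 7] ! ((d - 4) mod 5)"

definition upper_weight :: "nat \<Rightarrow> nat" where
  "upper_weight d = 2 * ((d - 4) div 5) + [0, 1, 2, 2, 2] ! ((d - 4) mod 5)"

text \<open>Periodicity reduces every weight inequality to finitely many gaps. The assumption keeps
  the truncated \<open>d - 4\<close> from spoiling the shift by a multiple of five.\<close>

lemma weights_add:
  assumes "4 \<le> d \<or> k = 0"
  shows "lower_weight (5 * k + d) = 8 * k + lower_weight d"
    and "upper_weight (5 * k + d) = 2 * k + upper_weight d"
    and "(5 * k + d - 4) mod 5 = (d - 4) mod 5"
proof -
  have "5 * k + d - 4 = (d - 4) + 5 * k" using assms by auto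
  then have "(5 * k + d - 4) div 5 = (d - 4) div 5 + k" 
    and "(5 * k + d - 4) mod 5 = (d - 4) mod 5"
    by simp_all
  then show "lower_weight (5 * k + d) = 8 * k + lower_weight d"
    and "upper_weight (5 * k + d) = 2 * k + upper_weight d"
    and "(5 * k + d - 4) mod 5 = (d - 4) mod 5"
    by (simp_all add: lower_weight_def upper_weight_def)
qed

text \<open>Representatives 4 to 8 cover the five residues; 1 to 3 are the gaps on which subtraction
  truncates, and these occur only with \<open>k = 0\<close>.\<close>

lemma gap_decomp:
  assumes "(d::nat) > 0"
  obtains k s where "d = 5 * k + s" "s \<in> {1..8}" "4 \<le> s \<or> k = 0"
proof (cases "d < 4")
  case True
  then show thesis using that[of 0 d] assms by auto
next
  case False
  have "(d - 4) mod 5 < 5" by simp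
  moreover have "d = 5 * ((d - 4) div 5) + ((d - 4) mod 5 + 4)" using False by simp
  ultimately show thesis using that[of "(d - 4) div 5" "(d - 4) mod 5 + 4"] by auto
qed

lemma weights_split_small:
  "\<forall>s\<in>{1..8}. \<forall>t\<in>{1..8}.
     (lower_weight (s + t) \<le> lower_weight s + lower_weight t + 7 \<or>
      lower_weight (s + t) = lower_weight s + lower_weight t + 8 \<and> 
        ((s - 4) mod 5 = 4 \<or> (t - 4) mod 5 = 4)) \<and>
     (s + t \<ge> 5 \<longrightarrow> upper_weight s + upper_weight t < upper_weight (s + t) \<or>
      upper_weight s + upper_weight t = upper_weight (s + t) \<and>
        ((s - 4) mod 5 \<ge> 2 \<or> (t - 4) mod 5 \<ge> 2))"
proof -
  have "{1..8} = {1, 2, 3, 4, 5, 6, 7, 8::nat}" by auto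
  then show ?thesis by (simp add: lower_weight_def upper_weight_def)
qed

text \<open>These describe the opponent's arbitrary move. A Dominator move costs at most 7 of the
  lower weight, or 8 if it leaves a residue 4 that Staller can exploit. A Staller move reduces the
  upper weight, or keeps it and leaves a residue of at least 2 that Dominator can exploit.\<close>

lemma
  assumes "0 < i" "0 < j"
  shows lower_weight_split: "lower_weight (i + j) \<le> lower_weight i + lower_weight j + 7 \<or>
      lower_weight (i + j) = lower_weight i + lower_weight j + 8 \<and>
        ((i - 4) mod 5 = 4 \<or> (j - 4) mod 5 = 4)"
    and upper_weight_split: "i + j \<ge> 5 \<Longrightarrow> upper_weight i + upper_weight j < upper_weight (i + j) \<or>
      upper_weight i + upper_weight j = upper_weight (i + j) \<and>
        ((i - 4) mod 5 \<ge> 2 \<or> (j - 4) mod 5 \<ge> 2)"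
proof -
  obtain k s where i: "i = 5 * k + s" "s \<in> {1..8}" "4 \<le> s \<or> k = 0"
    using gap_decomp[OF assms(1)] .
  obtain l t where j: "j = 5 * l + t" "t \<in> {1..8}" "4 \<le> t \<or> l = 0"
    using gap_decomp[OF assms(2)] .
  have ij: "i + j = 5 * (k + l) + (s + t)" "4 \<le> s + t \<or> k + l = 0"
    using i j by auto
  have w: "lower_weight (i + j) = 8 * (k + l) + lower_weight (s + t)"
    "upper_weight (i + j) = 2 * (k + l) + upper_weight (s + t)"
    "lower_weight i = 8 * k + lower_weight s" "upper_weight i = 2 * k + upper_weight s"
    "lower_weight j = 8 * l + lower_weight t" "upper_weight j = 2 * l + upper_weight t"
    "(i - 4) mod 5 = (s - 4) mod 5" "(j - 4) mod 5 = (t - 4) mod 5"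
    unfolding ij(1) unfolding i(1) j(1) by (intro weights_add i(3) j(3) ij(2))+
  note small = weights_split_small[rule_format, OF i(2) j(2)]
  from small show "lower_weight (i + j) \<le> lower_weight i + lower_weight j + 7 \<or>
      lower_weight (i + j) = lower_weight i + lower_weight j + 8 \<and>
        ((i - 4) mod 5 = 4 \<or> (j - 4) mod 5 = 4)"
    unfolding w by auto
  show "upper_weight i + upper_weight j < upper_weight (i + j) \<or>
      upper_weight i + upper_weight j = upper_weight (i + j) \<and>
        ((i - 4) mod 5 \<ge> 2 \<or> (j - 4) mod 5 \<ge> 2)" if "i + j \<ge> 5"
  proof (cases "s + t \<ge> 5")
    case True
    with small show ?thesis unfolding w by auto
  next
    case False
    \<comment> \<open>This case is contradictory: a positive \<open>k\<close> or \<open>l\<close>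
      forces \<open>s\<close> or \<open>t\<close> to be at least 4, and the other is at least
      1.\<close>
    with that ij have "s + t = 4" "k + l > 0" by auto
    with i j show ?thesis by auto
  qed
qed

text \<open>The cost to Staller of shortening a gap by one; the gap of length 1 that is split off
  has weight 0. Only residues 1 and 2 cost more than 1.\<close>

lemma lower_weight_pred:
  assumes "d \<ge> 5"
  shows "(d - 4) mod 5 = 4 \<Longrightarrow> lower_weight (d - 1) = lower_weight d"
    and "(d - 4) mod 5 \<in> {0, 3} \<Longrightarrow> lower_weight (d - 1) + 1 = lower_weight d"
    and "(d - 4) mod 5 = 2 \<Longrightarrow> lower_weight (d - 1) + 2 = lower_weight d"
    and "(d - 4) mod 5 = 1 \<Longrightarrow> lower_weight (d - 1) + 4 = lower_weight d"
proof -
  \<comment> \<open>Representatives 5 to 9 instead of 4 to 8, so that \<open>s - 1\<close> is still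
    at least 4 and periodicity applies to both \<open>d\<close> and \<open>d - 1\<close>.\<close>
  obtain k s where d: "d = 5 * k + s" "s \<in> {5..9}"
  proof
    show "d = 5 * ((d - 5) div 5) + ((d - 5) mod 5 + 5)" using assms by simp
    show "(d - 5) mod 5 + 5 \<in> {5..9}" by (simp add: less_Suc_eq_le[symmetric])
  qed
  then have d1: "d - 1 = 5 * k + (s - 1)" "4 \<le> s - 1" "4 \<le> s" by auto
  have w: "lower_weight d = 8 * k + lower_weight s" "(d - 4) mod 5 = (s - 4) mod 5"
    "lower_weight (d - 1) = 8 * k + lower_weight (s - 1)"
    unfolding d1(1) unfolding d(1) by (intro weights_add disjI1 d1(2,3))+
  have "s = 5 \<or> s = 6 \<or> s = 7 \<or> s = 8 \<or> s = 9" using d(2) by auto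
  then show "(d - 4) mod 5 = 4 \<Longrightarrow> lower_weight (d - 1) = lower_weight d"
    and "(d - 4) mod 5 \<in> {0, 3} \<Longrightarrow> lower_weight (d - 1) + 1 = lower_weight d"
    and "(d - 4) mod 5 = 2 \<Longrightarrow> lower_weight (d - 1) + 2 = lower_weight d"
    and "(d - 4) mod 5 = 1 \<Longrightarrow> lower_weight (d - 1) + 4 = lower_weight d"
    unfolding w by (elim disjE; simp add: lower_weight_def)+
qed

text \<open>The gain of Dominator from splitting off a gap of length 4, which itself has weight 0:
  one unit pays for the move, and residues from 2 on yield a second unit.\<close>

lemma upper_weight_minus_4:
  assumes "d \<ge> 5"
  shows "upper_weight (d - 4) + (if (d - 4) mod 5 \<ge> 2 then 2 else 1) = upper_weight d"
proof -
  obtain k s where d: "d = 5 * k + s" "s \<in> {5..9}"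
  proof
    show "d = 5 * ((d - 5) div 5) + ((d - 5) mod 5 + 5)" using assms by simp
    show "(d - 5) mod 5 + 5 \<in> {5..9}" by (simp add: less_Suc_eq_le[symmetric])
  qed
  have s: "s = 5 \<or> s = 6 \<or> s = 7 \<or> s = 8 \<or> s = 9" using d(2) by auto
  have w: "upper_weight d = 2 * k + upper_weight s" "(d - 4) mod 5 = (s - 4) mod 5"
    unfolding d(1) using d(2) by (auto intro!: weights_add)
  have "upper_weight (d - 4) + (if (s - 4) mod 5 \<ge> 2 then 2 else 1) = 2 * k + upper_weight s"
  proof (cases k)
    case 0
    with d(1) s show ?thesis by (auto simp: upper_weight_def)
  next
    case (Suc l)
    \<comment> \<open>One five is borrowed from \<open>k\<close>, because \<open>s - 4\<close> alone
      may fall below 4.\<close>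
    with d(1) have "d - 4 = 5 * l + (s + 1)" by simp
    moreover have "upper_weight (5 * l + (s + 1)) = 2 * l + upper_weight (s + 1)"
      using d(2) by (intro weights_add) auto
    ultimately show ?thesis using s Suc by (auto simp: upper_weight_def)
  qed
  then show ?thesis by (simp only: w)
qed

text \<open>When all residues are small, divisibility of the total weight lets Staller round away
  the loss of 2 or 4 incurred by shortening a gap.\<close>

lemma lower_weight_dvd:
  shows "(d - 4) mod 5 \<le> 1 \<Longrightarrow> 4 dvd lower_weight d"
    and "(d - 4) mod 5 \<le> 2 \<Longrightarrow> 2 dvd lower_weight d"
proof -
  have "r = 0 \<or> r = 1" if "r \<le> 1" for r :: nat using that by auto
  moreover have "r = 0 \<or> r = 1 \<or> r = 2" if "r \<le> 2" for r :: nat using that by auto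
  ultimately show "(d - 4) mod 5 \<le> 1 \<Longrightarrow> 4 dvd lower_weight d"
    and "(d - 4) mod 5 \<le> 2 \<Longrightarrow> 2 dvd lower_weight d"
    unfolding lower_weight_def by fastforce+
qed

lemma weights_eq_0: "d < 5 \<Longrightarrow> lower_weight d = 0" "d < 5 \<Longrightarrow> upper_weight d = 0"
  by (simp_all add: lower_weight_def upper_weight_def)

lemma dvd_sum_list:
  fixes c :: nat
  shows "(\<And>y. y \<in> set ys \<Longrightarrow> c dvd y) \<Longrightarrow> c dvd sum_list ys"
  by (induction ys) auto

section \<open>Positions on the cycle\<close>

definition composition :: "nat \<Rightarrow> nat list \<Rightarrow> bool" where
  "composition n ds \<longleftrightarrow> sum_list ds = n \<and> (\<forall>d\<in>set ds. 0 < d)"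

text \<open>Each move lengthens the list of gaps by one, so this bound makes
  \<open>n - length ds\<close> a decreasing measure for induction on the game.\<close>

lemma composition_length: "composition n ds \<Longrightarrow> length ds \<le> n"
proof (induction ds arbitrary: n)
  case (Cons d ds)
  then have "length ds \<le> sum_list ds" "0 < d" by (auto simp: composition_def)
  with Cons.prems show ?case by (auto simp: composition_def)
qed simp

lemma composition_split:
  "composition n (as @ d # bs) \<Longrightarrow> 0 < j \<Longrightarrow> j < d \<Longrightarrow> composition n (as @ j # (d - j) # bs)"
  by (auto simp: composition_def)

lemma position_in_composition:
  fixes ds :: "nat list"
  assumes "t < sum_list ds"
  obtains as d bs j where "ds = as @ d # bs" "t = sum_list as + j" "j < d"
  using assms
proof (induction ds arbitrary: t thesis)
  case (Cons d ds)
  show ?case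
  proof (cases "t < d")
    case True
    then show ?thesis using Cons.prems(1)[of "[]"] by simp
  next
    case False
    then have "t - d < sum_list ds" using Cons.prems(2) by simp
    then obtain as e bs j where "ds = as @ e # bs" "t - d = sum_list as + j" "j < e"
      using Cons.IH by blast
    then show ?thesis using Cons.prems(1)[of "d # as" e bs j] False by simp
  qed
qed simp

locale cycle_game =
  fixes n :: nat
  assumes n_ge_4: "n \<ge> 4"
begin

sublocale graph "with_proj (cycle_graph n)"
  using n_ge_4 by (intro graph_cycle_graph) simp

text \<open>The selected vertices when \<open>x\<close> is one of them and the gaps following it are listed in order.\<close>

fun marks :: "nat \<Rightarrow> nat list \<Rightarrow> nat set" where
  "marks x [] = {}"
| "marks x (d # ds) = insert (x mod n) (marks (x + d) ds)"

lemma marks_append: "marks x (as @ bs) = marks x as \<union> marks (x + sum_list as) bs"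
  by (induction as arbitrary: x) (auto simp: add.assoc)

lemma marks_iff: "y \<in> marks x ds \<longleftrightarrow> (\<exists>as d bs. ds = as @ d # bs \<and> y = (x + sum_list as) mod n)"
proof
  assume "y \<in> marks x ds"
  then show "\<exists>as d bs. ds = as @ d # bs \<and> y = (x + sum_list as) mod n"
  proof (induction ds arbitrary: x)
    case (Cons d ds)
    then consider "y = x mod n" | "y \<in> marks (x + d) ds" by auto
    then show ?case
    proof cases
      case 1
      then show ?thesis by (intro exI[of _ "[]"]) auto
    next
      case 2
      then obtain as e bs where "ds = as @ e # bs" "y = (x + d + sum_list as) mod n"
        using Cons.IH by blast
      then show ?thesis by (intro exI[of _ "d # as"]) (auto simp: add.assoc)
    qed
  qed simp
qed (auto simp: marks_append)

lemma marks_split: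
  assumes "0 < j" "j < d"
  shows "insert ((x + sum_list as + j) mod n) (marks x (as @ d # bs)) =
    marks x (as @ j # (d - j) # bs)"
  using assms by (auto simp: marks_append add.assoc)

lemma add_mod_inj:
  assumes "(x + s) mod n = (x + t) mod n" "s < n" "t < n"
  shows "s = t"
  using assms
proof (induction s t rule: linorder_wlog)
  case (le s t)
  then have "n dvd t - s" using mod_eq_dvd_iff_nat[of "x + s" "x + t" n] by simp
  then show ?case using le by (auto dest: dvd_imp_le)
qed simp

text \<open>All positions involved are less than \<open>n\<close> steps from \<open>x\<close>,
  except possibly the end of the last gap, so equality modulo \<open>n\<close> becomes equality of
  partial sums. Including \<open>j = d\<close> covers the right neighbour of the last vertex in the
  gap.\<close>

lemma marks_within_gap:
  assumes "composition n (as @ d # bs)" "j \<le> d"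
  shows "(x + sum_list as + j) mod n \<in> marks x (as @ d # bs) \<longleftrightarrow> j = 0 \<or> j = d"
proof
  assume "j = 0 \<or> j = d"
  then show "(x + sum_list as + j) mod n \<in> marks x (as @ d # bs)"
  proof
    assume "j = d"
    show ?thesis
    \<comment> \<open>If the gap is the last one, its right end wraps around to the starting mark
      \<open>x\<close>.\<close>
    proof (cases bs)
      case Nil
      then have "sum_list as + d = n" using assms by (simp add: composition_def)
      then have "(x + sum_list as + j) mod n = x mod n" using \<open>j = d\<close> by (simp add: add.assoc)
      then show ?thesis by (cases as) auto
    next
      case (Cons e cs)
      then show ?thesis using \<open>j = d\<close> by (simp add: marks_append)
    qed
  qed (simp add: marks_append)
next
  assume "(x + sum_list as + j) mod n \<in> marks x (as @ d # bs)"
  then obtain as' d' bs' where split: "as @ d # bs = as' @ d' # bs'"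
    and eq: "(x + (sum_list as + j)) mod n = (x + sum_list as') mod n"
    by (auto simp: marks_iff add.assoc)
  show "j = 0 \<or> j = d"
  proof (rule ccontr)
    assume j: "\<not> (j = 0 \<or> j = d)"
    have "composition n (as' @ d' # bs')" using assms(1) split by simp
    then have "sum_list as' < n" by (auto simp: composition_def)
    moreover have "sum_list as + j < n" using assms j by (auto simp: composition_def)
    ultimately have sums: "sum_list as + j = sum_list as'"
      using eq add_mod_inj by blast
    from split consider us where "as' = as @ us" "d # bs = us @ d' # bs'"
      | us where "as = as' @ us" "us @ d # bs = d' # bs'"
      by (auto simp: append_eq_append_conv2)
    then show False
    proof cases
      case 1
      then show False using sums assms(2) j by (cases us) auto
    next
      case 2
      then show False using sums j by auto
    qed
  qed
qed

section \<open>Adjacency, domination and legal moves inside a gap\<close>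

lemma arc_iff:
  "u \<rightarrow>\<^bsub>with_proj (cycle_graph n)\<^esub> v \<longleftrightarrow>
    u < n \<and> v < n \<and> (v = (u + 1) mod n \<or> u = (v + 1) mod n)"
  by (auto simp: cycle_graph_def)

lemma arc_mod_iff:
  assumes "0 < p"
  shows "u \<rightarrow>\<^bsub>with_proj (cycle_graph n)\<^esub> (p mod n) \<longleftrightarrow> u = (p - 1) mod n \<or> u = (p + 1) mod n"
    and "(p mod n) \<rightarrow>\<^bsub>with_proj (cycle_graph n)\<^esub> u \<longleftrightarrow> u = (p - 1) mod n \<or> u = (p + 1) mod n"
proof -
  have n: "0 < n" using n_ge_4 by simp
  have "u = (p - 1) mod n" if "u < n" "p mod n = (u + 1) mod n"
  proof -
    have "(1 + (p - 1) mod n) mod n = (1 + u) mod n" using that assms by (simp add: mod_simps)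
    then show ?thesis using add_mod_inj[of 1 "(p - 1) mod n" u] that n by simp
  qed
  moreover have "p mod n = ((p - 1) mod n + 1) mod n"
    using assms by (simp add: mod_simps)
  moreover have "(p mod n + 1) mod n = (p + 1) mod n"
    by (simp add: mod_simps)
  ultimately show "u \<rightarrow>\<^bsub>with_proj (cycle_graph n)\<^esub> (p mod n) \<longleftrightarrow> u = (p - 1) mod n \<or> u = (p + 1) mod n"
    and "(p mod n) \<rightarrow>\<^bsub>with_proj (cycle_graph n)\<^esub> u \<longleftrightarrow> u = (p - 1) mod n \<or> u = (p + 1) mod n"
    unfolding arc_iff using n by (auto simp del: mod_Suc_eq)
qed

lemma pverts_eq: "pverts (cycle_graph n) = {0..<n}"
  by (simp add: cycle_graph_def)

lemma undominated_iff:
  assumes "composition n (as @ d # bs)" "j < d"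
  shows "(x + sum_list as + j) mod n \<notin> closed_nbhd (marks x (as @ d # bs)) \<longleftrightarrow> 2 \<le> j \<and> j + 2 \<le> d"
\<comment> \<open>The left end is itself selected. It is treated apart because its left neighbour
  lies in another gap or across the wrap-around, so \<open>j - 1\<close> would not describe
  it.\<close>
proof (cases "j = 0")
  case True
  then show ?thesis
    using marks_within_gap[OF assms(1), of 0 x] n_ge_4 by (auto simp: closed_nbhd_def pverts_eq)
next
  case False
  let ?p = "x + sum_list as + j" and ?X = "marks x (as @ d # bs)"
  have "?p mod n \<notin> closed_nbhd ?X \<longleftrightarrow> ?p mod n \<notin> ?X \<and> (?p - 1) mod n \<notin> ?X \<and> (?p + 1) mod n \<notin> ?X"
    using False n_ge_4 arc_mod_iff(1)[of ?p] by (auto simp: closed_nbhd_def pverts_eq)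
  moreover have "?p - 1 = x + sum_list as + (j - 1)" "?p + 1 = x + sum_list as + (j + 1)"
    using False by simp_all
  ultimately show ?thesis
    using marks_within_gap[OF assms(1), of j x] marks_within_gap[OF assms(1), of "j - 1" x]
      marks_within_gap[OF assms(1), of "j + 1" x] assms(2) False by auto
qed

text \<open>The undominated vertices of a gap are at offsets 2 to \<open>d - 2\<close>. They span an
  edge exactly when \<open>d\<close> is at least 5, and then the vertices dominating them are
  precisely the interior offsets 1 to \<open>d - 1\<close>.\<close>

lemma playable_marks_iff:
  assumes "composition n ds"
  shows "z \<in> playable (marks x ds) \<longleftrightarrow>
    (\<exists>as d bs j. ds = as @ d # bs \<and> 5 \<le> d \<and> 0 < j \<and> j < d \<and> z = (x + sum_list as + j) mod n)"
    (is "_ \<longleftrightarrow> ?R")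
proof
  assume "z \<in> playable (marks x ds)"
  then obtain v w where v: "v < n" "v \<notin> closed_nbhd (marks x ds)" and w: "w \<notin> closed_nbhd (marks x ds)"
    and vw: "v \<rightarrow>\<^bsub>with_proj (cycle_graph n)\<^esub> w"
    and z: "v = z \<or> z \<rightarrow>\<^bsub>with_proj (cycle_graph n)\<^esub> v"
    unfolding playable_iff with_proj_simps(1) pverts_eq by auto
  \<comment> \<open>The offset of \<open>v\<close> from \<open>x\<close> along the cycle, with
    \<open>n - x mod n\<close> standing for \<open>- x\<close> in the natural numbers.\<close>
  define t where "t = (v + (n - x mod n)) mod n"
  have "t < sum_list ds" using assms v by (simp add: t_def composition_def)
  have "(x + t) mod n = (x mod n + (v + (n - x mod n))) mod n"
    unfolding t_def by (simp add: mod_simps)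
  also have "x mod n + (v + (n - x mod n)) = v + n"
    using n_ge_4 mod_less_divisor[of n x] by linarith
  finally have xt: "(x + t) mod n = v" using v by simp
  obtain as d bs j where ds: "ds = as @ d # bs" "t = sum_list as + j" "j < d"
    using \<open>t < sum_list ds\<close> by (rule position_in_composition)
  note comp = assms[unfolded ds(1)]
  have v_eq: "v = (x + sum_list as + j) mod n" using xt ds(2) by (simp add: add.assoc)
  have j: "2 \<le> j" "j + 2 \<le> d"
    using undominated_iff[OF comp ds(3)] v(2) v_eq ds(1) by blast+
  then have pos: "0 < x + sum_list as + j"
    and shift: "x + sum_list as + j - 1 = x + sum_list as + (j - 1)" by simp_all
  have "w = (x + sum_list as + (j - 1)) mod n \<or> w = (x + sum_list as + (j + 1)) mod n"
    using vw arc_mod_iff(2)[OF pos] unfolding v_eq shift by (simp add: add.assoc)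
  moreover have "j - 1 < d" "j + 1 < d" using j by auto
  ultimately have "5 \<le> d"
    using undominated_iff[OF comp, of "j - 1" x] undominated_iff[OF comp, of "j + 1" x] w j
    unfolding ds(1) by fastforce
  moreover have "z = (x + sum_list as + j) mod n \<or> z = (x + sum_list as + (j - 1)) mod n \<or>
      z = (x + sum_list as + (j + 1)) mod n"
    using z arc_mod_iff(1)[OF pos] unfolding v_eq shift by (auto simp: add.assoc)
  moreover have "0 < j - 1" "j + 1 < d" "0 < j" "j < d" "j - 1 < d" "0 < j + 1" using j by auto
  ultimately show ?R using ds(1) by metis
next
  assume ?R
  then obtain as d bs j where ds: "ds = as @ d # bs" and d: "5 \<le> d" and j: "0 < j" "j < d"
    and z: "z = (x + sum_list as + j) mod n" by blast
  note comp = assms[unfolded ds]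
  \<comment> \<open>\<open>i\<close> is an undominated offset equal or adjacent to \<open>j\<close>:
    the two outermost choices move inwards by one. \<open>i'\<close> is a neighbour of
    \<open>i\<close> that is again undominated, which exists since \<open>d\<close> is at least
    5.\<close>
  define i where "i = (if j = 1 then 2 else if j = d - 1 then d - 2 else j)"
  define i' where "i' = (if i = d - 2 then i - 1 else i + 1)"
  have i: "2 \<le> i" "i + 2 \<le> d" "2 \<le> i'" "i' + 2 \<le> d" "j = i \<or> j = i - 1 \<or> j = i + 1"
    "i' = i - 1 \<or> i' = i + 1"
    using d j by (auto simp: i_def i'_def)
  let ?v = "(x + sum_list as + i) mod n" and ?w = "(x + sum_list as + i') mod n"
  have pos: "0 < x + sum_list as + i"
    and shift: "x + sum_list as + i - 1 = x + sum_list as + (i - 1)" using i by simp_all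
  have "?v \<notin> closed_nbhd (marks x ds)" "?w \<notin> closed_nbhd (marks x ds)"
    unfolding ds using i undominated_iff[OF comp, of i x] undominated_iff[OF comp, of i' x] by auto
  moreover have "?v \<rightarrow>\<^bsub>with_proj (cycle_graph n)\<^esub> ?w"
    using i(6) unfolding arc_mod_iff(2)[OF pos] shift by (auto simp: add.assoc)
  moreover have "?v = z \<or> z \<rightarrow>\<^bsub>with_proj (cycle_graph n)\<^esub> ?v"
    using i(5) unfolding arc_mod_iff(1)[OF pos] shift z by (auto simp: add.assoc)
  moreover have "z < n" "?v < n" "?w < n" using z n_ge_4 by simp_all
  ultimately show "z \<in> playable (marks x ds)"
    unfolding playable_iff with_proj_simps(1) pverts_eq by (metis Diff_iff atLeastLessThan_iff zero_le)
qed

lemma playable_marks_split: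
  assumes "composition n (as @ d # bs)" "5 \<le> d" "0 < j" "j < d"
  shows "(x + sum_list as + j) mod n \<in> playable (marks x (as @ d # bs))"
  using assms playable_marks_iff by blast

lemma playable_marks_empty_iff:
  assumes "composition n ds"
  shows "playable (marks x ds) = {} \<longleftrightarrow> (\<forall>d\<in>set ds. d < 5)"
proof
  assume "playable (marks x ds) = {}"
  then show "\<forall>d\<in>set ds. d < 5"
    using playable_marks_split[of _ _ _ 1 x] assms by (fastforce simp: in_set_conv_decomp not_less)
next
  assume "\<forall>d\<in>set ds. d < 5"
  then show "playable (marks x ds) = {}"
    using playable_marks_iff[OF assms] by fastforce
qed

section \<open>Strategies\<close>

text \<open>The three bounds are proved jointly: Dominator's follows from both Staller bounds after
  an arbitrary move, and Staller's follow from Dominator's bound after shortening a suitable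
  gap.\<close>

lemma remaining_moves_lower_bound:
  assumes "composition n ds"
  defines "W \<equiv> sum_list (map lower_weight ds)"
  shows "W \<le> 4 * remaining_moves Dominator (marks x ds) + 3 \<and>
    W \<le> 4 * remaining_moves Staller (marks x ds) \<and>
    ((\<exists>d\<in>set ds. (d - 4) mod 5 = 4) \<longrightarrow> W + 1 \<le> 4 * remaining_moves Staller (marks x ds))"
  using assms(1) unfolding W_def
proof (induction "n - length ds" arbitrary: ds rule: less_induct)
  case less
  define W where "W = sum_list (map lower_weight ds)"
  have IH: "W' \<le> 4 * remaining_moves Dominator (marks x ds') + 3"
    "W' \<le> 4 * remaining_moves Staller (marks x ds')"
    "\<exists>d\<in>set ds'. (d - 4) mod 5 = 4 \<Longrightarrow> W' + 1 \<le> 4 * remaining_moves Staller (marks x ds')"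
    if "ds = as @ d # bs" "0 < j" "j < d" "ds' = as @ j # (d - j) # bs"
      "W' = sum_list (map lower_weight ds')" for as d bs j ds' W'
  proof -
    have comp: "composition n ds'" using less.prems that composition_split by simp
    then have "n - length ds' < n - length ds"
      using composition_length[OF comp] that by simp
    from less.hyps[OF this comp, folded that(5)] show "W' \<le> 4 * remaining_moves Dominator (marks x ds') + 3"
    "W' \<le> 4 * remaining_moves Staller (marks x ds')"
    "\<exists>d\<in>set ds'. (d - 4) mod 5 = 4 \<Longrightarrow> W' + 1 \<le> 4 * remaining_moves Staller (marks x ds')"
      by blast+
  qed
  have "W \<le> 4 * remaining_moves Dominator (marks x ds) + 3"
  proof (cases "playable (marks x ds) = {}")
    case True
    then have "W = 0"
      using less.prems by (simp add: W_def playable_marks_empty_iff weights_eq_0)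
    then show ?thesis by simp
  next
    case False
    \<comment> \<open>A form of the goal with a successor on the left. For \<open>W < 4\<close> it
      only says that a move remains, which suffices because of the slack 3.\<close>
    have "Suc ((W - 4) div 4) \<le> remaining_moves Dominator (marks x ds)"
    proof (rule remaining_moves_Dominator_ge[OF False])
      fix y assume "y \<in> playable (marks x ds)"
      then obtain as d bs j where ds: "ds = as @ d # bs" and j: "0 < j" "j < d"
        and y: "y = (x + sum_list as + j) mod n"
        using playable_marks_iff[OF less.prems] by blast
      define ds' where "ds' = as @ j # (d - j) # bs"
      define W' where "W' = sum_list (map lower_weight ds')"
      have sum: "W + lower_weight j + lower_weight (d - j) = W' + lower_weight d"
        by (simp add: W_def W'_def ds ds'_def)
      have "lower_weight d \<le> lower_weight j + lower_weight (d - j) + 7 \<or>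
        lower_weight d = lower_weight j + lower_weight (d - j) + 8 \<and>
        ((j - 4) mod 5 = 4 \<or> (d - j - 4) mod 5 = 4)"
        using lower_weight_split[of j "d - j"] j by simp
      then have "W \<le> W' + 7 \<or> W = W' + 8 \<and> (\<exists>d\<in>set ds'. (d - 4) mod 5 = 4)"
        using sum by (auto simp: ds'_def)
      then have "W \<le> 4 * remaining_moves Staller (marks x ds') + 7"
        using IH(2,3)[OF ds j ds'_def W'_def] by fastforce
      moreover have "insert y (marks x ds) = marks x ds'"
        using j by (simp add: y ds ds'_def marks_split)
      ultimately show "(W - 4) div 4 \<le> remaining_moves Staller (insert y (marks x ds))"
        by simp
    qed
    then show ?thesis by linarith
  qed
  \<comment> \<open>Staller selects the vertex next to a selected one, and \<open>c\<close> is the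
    weight lost. The move counts 4 and Dominator's bound has slack 3, which leaves the surplus
    1.\<close>
  moreover have reply: "W + 1 \<le> 4 * remaining_moves Staller (marks x ds) + c"
    if "d \<in> set ds" "5 \<le> d" "lower_weight (d - 1) + c = lower_weight d" for d c
  proof -
    from that(1) obtain as bs where ds: "ds = as @ d # bs" by (auto simp: in_set_conv_decomp)
    have d: "0 < (1::nat)" "1 < d" using that(2) by auto
    define ds' where "ds' = as @ 1 # (d - 1) # bs"
    define W' where "W' = sum_list (map lower_weight ds')"
    have "W = W' + c"
      using that(3) weights_eq_0(1)[of 1] by (simp add: W_def W'_def ds ds'_def)
    moreover have "Suc (remaining_moves Dominator (marks x ds')) \<le> remaining_moves Staller (marks x ds)"
    proof (rule remaining_moves_Staller_ge)
      show "(x + sum_list as + 1) mod n \<in> playable (marks x ds)"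
        using less.prems that(2) d unfolding ds by (intro playable_marks_split)
      show "remaining_moves Dominator (marks x ds')
        \<le> remaining_moves Dominator (insert ((x + sum_list as + 1) mod n) (marks x ds))"
        using d by (simp only: ds ds'_def marks_split order_refl)
    qed
    ultimately show ?thesis using IH(1)[OF ds d ds'_def W'_def] by linarith
  qed
  have strong: "W + 1 \<le> 4 * remaining_moves Staller (marks x ds)"
    if "\<exists>d\<in>set ds. (d - 4) mod 5 = 4"
  proof -
    from that obtain d where d: "d \<in> set ds" "(d - 4) mod 5 = 4" by blast
    then have "5 \<le> d" by (cases "5 \<le> d") auto
    with d lower_weight_pred(1) have "lower_weight (d - 1) + 0 = lower_weight d" by simp
    from reply[OF d(1) \<open>5 \<le> d\<close> this] show ?thesis by simp
  qed
  moreover have "W \<le> 4 * remaining_moves Staller (marks x ds)"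
  proof -
    define res :: "nat \<Rightarrow> nat" where "res d = (d - 4) mod 5" for d
    have res_less: "res d < 5" and res_0: "d < 5 \<Longrightarrow> res d = 0" for d
      by (simp_all add: res_def)
    \<comment> \<open>Staller shortens a long gap of largest residue. A loss of at most 1 is covered
      by the surplus in \<open>reply\<close>; a loss of 2 or 4 occurs only when all residues are at
      most 2 or 1, and then divisibility of \<open>W\<close> closes the deficit.\<close>
    consider (no_large) "\<forall>d\<in>set ds. d < 5"
      | (res_4) d where "d \<in> set ds" "5 \<le> d" "res d = 4"
      | (res_03) d where "d \<in> set ds" "5 \<le> d" "res d \<in> {0, 3}"
      | (res_2) d where "d \<in> set ds" "5 \<le> d" "res d = 2" "\<forall>d\<in>set ds. res d \<le> 2"
      | (res_1) d where "d \<in> set ds" "5 \<le> d" "res d = 1" "\<forall>d\<in>set ds. res d \<le> 1"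
    proof (cases "set ds \<subseteq> {..<5}")
      case True
      then show thesis using no_large by auto
    next
      case False
      \<comment> \<open>Only gaps of length at least 5 can be split. Shorter ones have residue 0, so
        \<open>m\<close> still bounds the residue of every gap.\<close>
      define m where "m = Max (res ` {d \<in> set ds. 5 \<le> d})"
      have "m \<in> res ` {d \<in> set ds. 5 \<le> d}"
        unfolding m_def using False by (intro Max_in) (auto simp: not_less)
      then obtain d where d: "d \<in> set ds" "5 \<le> d" "res d = m" by blast
      have le_m: "res e \<le> m" if "e \<in> set ds" for e
      proof (cases "e < 5")
        case True
        then show ?thesis by (simp add: res_0)
      next
        case False
        then show ?thesis unfolding m_def using that by (intro Max_ge) auto
      qed
      have "m = 0 \<or> m = 1 \<or> m = 2 \<or> m = 3 \<or> m = 4"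
        using res_less[of d] d(3) by linarith
      then show thesis
      proof (elim disjE)
        assume "m = 0" then show thesis using res_03 d by simp
      next
        assume "m = 1" then show thesis using res_1[OF d(1,2)] d(3) le_m by simp
      next
        assume "m = 2" then show thesis using res_2[OF d(1,2)] d(3) le_m by simp
      next
        assume "m = 3" then show thesis using res_03 d by simp
      next
        assume "m = 4" then show thesis using res_4 d by simp
      qed
    qed
    then show ?thesis
    proof cases
      case no_large
      then have "W = 0" by (simp add: W_def weights_eq_0)
      then show ?thesis by simp
    next
      case res_4
      then have "W + 1 \<le> 4 * remaining_moves Staller (marks x ds)"
        unfolding res_def by (intro strong bexI)
      then show ?thesis by simp
    next
      case res_03
      show ?thesis
        using reply[OF res_03(1,2) lower_weight_pred(2)[OF res_03(2) res_03(3)[unfolded res_def]]] by simp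
    next
      case res_2
      have "W + 1 \<le> 4 * remaining_moves Staller (marks x ds) + 2"
        using reply[OF res_2(1,2) lower_weight_pred(3)[OF res_2(2) res_2(3)[unfolded res_def]]] .
      moreover have "2 dvd W"
        unfolding W_def using res_2(4) lower_weight_dvd(2)[folded res_def] by (intro dvd_sum_list) auto
      ultimately show ?thesis by presburger
    next
      case res_1
      have "W + 1 \<le> 4 * remaining_moves Staller (marks x ds) + 4"
        using reply[OF res_1(1,2) lower_weight_pred(4)[OF res_1(2) res_1(3)[unfolded res_def]]] .
      moreover have "4 dvd W"
        unfolding W_def using res_1(4) lower_weight_dvd(1)[folded res_def] by (intro dvd_sum_list) auto
      ultimately show ?thesis by presburger
    qed
  qed
  ultimately show ?case
    unfolding W_def by blast
qed

text \<open>Again a joint induction: a Staller move that fails to lower \<open>U\<close> creates a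
  gap for which Dominator's sharper bound holds, and Dominator's split at 4 reduces to the bound
  with Staller to move.\<close>

lemma remaining_moves_upper_bound:
  assumes "composition n ds"
  defines "U \<equiv> sum_list (map upper_weight ds)"
  shows "remaining_moves Staller (marks x ds) \<le> U \<and> remaining_moves Dominator (marks x ds) \<le> U \<and>
    ((\<exists>d\<in>set ds. 2 \<le> (d - 4) mod 5) \<longrightarrow> remaining_moves Dominator (marks x ds) + 1 \<le> U)"
  using assms(1) unfolding U_def
proof (induction "n - length ds" arbitrary: ds rule: less_induct)
  case less
  define U where "U = sum_list (map upper_weight ds)"
  have IH: "remaining_moves Staller (marks x ds') \<le> U'"
    "remaining_moves Dominator (marks x ds') \<le> U'"
    "\<exists>d\<in>set ds'. 2 \<le> (d - 4) mod 5 \<Longrightarrow> remaining_moves Dominator (marks x ds') + 1 \<le> U'"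
    if "ds = as @ d # bs" "0 < j" "j < d" "ds' = as @ j # (d - j) # bs"
      "U' = sum_list (map upper_weight ds')" for as d bs j ds' U'
  proof -
    have comp: "composition n ds'" using less.prems that composition_split by simp
    then have "n - length ds' < n - length ds"
      using composition_length[OF comp] that by simp
    from less.hyps[OF this comp, folded that(5)] show "remaining_moves Staller (marks x ds') \<le> U'"
      "remaining_moves Dominator (marks x ds') \<le> U'"
      "\<exists>d\<in>set ds'. 2 \<le> (d - 4) mod 5 \<Longrightarrow> remaining_moves Dominator (marks x ds') + 1 \<le> U'"
      by blast+
  qed
  have "remaining_moves Staller (marks x ds) \<le> U"
  proof (cases "playable (marks x ds) = {}")
    case True
    then show ?thesis by (simp add: remaining_moves_eq_0)
  next
    case False
    have bound: "remaining_moves Dominator (insert y (marks x ds)) + 1 \<le> U"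
      if "y \<in> playable (marks x ds)" for y
    proof -
      from that obtain as d bs j where ds: "ds = as @ d # bs" and d: "5 \<le> d" and j: "0 < j" "j < d"
        and y: "y = (x + sum_list as + j) mod n"
        using playable_marks_iff[OF less.prems] by blast
      define ds' where "ds' = as @ j # (d - j) # bs"
      define U' where "U' = sum_list (map upper_weight ds')"
      have sum: "U + upper_weight j + upper_weight (d - j) = U' + upper_weight d"
        by (simp add: U_def U'_def ds ds'_def)
      have "upper_weight j + upper_weight (d - j) < upper_weight d \<or>
        upper_weight j + upper_weight (d - j) = upper_weight d \<and>
        ((j - 4) mod 5 \<ge> 2 \<or> (d - j - 4) mod 5 \<ge> 2)"
        using upper_weight_split[of j "d - j"] d j by simp
      then have "U' < U \<or> U' = U \<and> (\<exists>d\<in>set ds'. 2 \<le> (d - 4) mod 5)"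
        using sum by (auto simp: ds'_def)
      moreover have "insert y (marks x ds) = marks x ds'"
        using j by (simp add: y ds ds'_def marks_split)
      ultimately show ?thesis
        using IH(2,3)[OF ds j ds'_def U'_def] by fastforce
    qed
    \<comment> \<open>The truncated \<open>U - 1\<close> is harmless, since \<open>bound\<close>
      applied to any legal move shows that \<open>U\<close> is positive.\<close>
    then have "remaining_moves Staller (marks x ds) \<le> Suc (U - 1)"
      using False by (intro remaining_moves_Staller_le) fastforce+
    moreover have "0 < U" using bound False by fastforce
    ultimately show ?thesis by simp
  qed
  moreover have move: "remaining_moves Dominator (marks x ds) + (if 2 \<le> (d - 4) mod 5 then 1 else 0) \<le> U"
    if "d \<in> set ds" "5 \<le> d" for d
  proof -
    from that(1) obtain as bs where ds: "ds = as @ d # bs" by (auto simp: in_set_conv_decomp)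
    have d: "0 < (4::nat)" "4 < d" using that(2) by auto
    define ds' where "ds' = as @ 4 # (d - 4) # bs"
    define U' where "U' = sum_list (map upper_weight ds')"
    have "U = U' + (if 2 \<le> (d - 4) mod 5 then 2 else 1)"
      using upper_weight_minus_4[OF that(2)] weights_eq_0(2)[of 4] by (simp add: U_def U'_def ds ds'_def)
    moreover have "remaining_moves Dominator (marks x ds) \<le> Suc U'"
    proof (rule remaining_moves_Dominator_le)
      show "(x + sum_list as + 4) mod n \<in> playable (marks x ds)"
        using less.prems that(2) d unfolding ds by (intro playable_marks_split)
      have "insert ((x + sum_list as + 4) mod n) (marks x ds) = marks x ds'"
        using d by (simp only: ds ds'_def marks_split)
      then show "remaining_moves Staller (insert ((x + sum_list as + 4) mod n) (marks x ds)) \<le> U'"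
        using IH(1)[OF ds d ds'_def U'_def] by simp
    qed
    ultimately show ?thesis by (simp split: if_splits)
  qed
  moreover have "remaining_moves Dominator (marks x ds) \<le> U"
  proof (cases "playable (marks x ds) = {}")
    case True
    then show ?thesis by (simp add: remaining_moves_eq_0)
  next
    case False
    then obtain d where "d \<in> set ds" "5 \<le> d"
      using playable_marks_empty_iff[OF less.prems] by (auto simp: not_less)
    then show ?thesis using move by fastforce
  qed
  moreover have "remaining_moves Dominator (marks x ds) + 1 \<le> U"
    if hot: "\<exists>d\<in>set ds. 2 \<le> (d - 4) mod 5"
  proof -
    from hot obtain d where d: "d \<in> set ds" "2 \<le> (d - 4) mod 5" by blast
    then have "5 \<le> d" by (cases "5 \<le> d") auto
    from move[OF d(1) this] d(2) show ?thesis by simp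
  qed
  ultimately show ?case
    unfolding U_def by blast
qed

section \<open>The first move and the exact values\<close>

lemma first_move:
  shows "playable {} = {0..<n}" and "y < n \<Longrightarrow> insert y {} = marks y [n]"
proof -
  have "x \<in> playable {}" if "x < n" for x
  proof -
    have "x \<rightarrow>\<^bsub>with_proj (cycle_graph n)\<^esub> ((x + 1) mod n)" "(x + 1) mod n < n"
      using that n_ge_4 unfolding arc_iff by auto
    moreover have "closed_nbhd {} = {}" by (simp add: closed_nbhd_def)
    ultimately show ?thesis
      using that unfolding playable_iff with_proj_simps(1) pverts_eq by (metis Diff_empty atLeastLessThan_iff zero_le)
  qed
  then show "playable {} = {0..<n}"
    using playable_subset_verts[of "{}"] by (auto simp: pverts_eq)
qed simp

text \<open>The empty position has no gaps and is handled separately. Any first move produces the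
  single gap \<open>n\<close>, so a value common to all starting vertices makes the choice
  irrelevant.\<close>

lemma remaining_moves_first:
  assumes "\<And>y. y < n \<Longrightarrow> remaining_moves Staller (marks y [n]) = s"
    and "\<And>y. y < n \<Longrightarrow> remaining_moves Dominator (marks y [n]) = e"
  shows "game_isolation_number = Suc s" and "staller_game_isolation_number = Suc e"
proof -
  have n: "0 < n" using n_ge_4 by simp
  have *: "remaining_moves Staller {y} = s" "remaining_moves Dominator {y} = e" if "y < n" for y
    using assms that first_move(2) by metis+
  show "game_isolation_number = Suc s"
    unfolding game_isolation_number_def using n
    by (intro antisym remaining_moves_Dominator_le[of 0] remaining_moves_Dominator_ge)
      (auto simp: first_move(1) *)
  show "staller_game_isolation_number = Suc e"
    unfolding staller_game_isolation_number_def using n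
    by (intro antisym remaining_moves_Staller_ge[of 0] remaining_moves_Staller_le)
      (auto simp: first_move(1) *)
qed

text \<open>For a single gap the bounds meet: a quarter of the lower weight, rounded up with Staller
  to move and down with Dominator to move, equals the upper bound, which is one less than the upper
  weight if Dominator is to move and \<open>r\<close> is at least 2.\<close>

lemma isolation_numbers:
  assumes "n = 5 * k + r + 4" "r < 5"
  shows "game_isolation_number = 2 * k + [1, 2, 3, 3, 3] ! r"
    and "staller_game_isolation_number = 2 * k + [1, 2, 2, 2, 2] ! r"
proof -
  have comp: "composition n [n]" using n_ge_4 by (simp add: composition_def)
  have r: "r = 0 \<or> r = 1 \<or> r = 2 \<or> r = 3 \<or> r = 4" using assms(2) by auto
  have r_eq: "(n - 4) mod 5 = r" "(n - 4) div 5 = k" using assms by auto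
  note lower = remaining_moves_lower_bound[OF comp, unfolded list.map sum_list_simps add_0_right lower_weight_def r_eq]
  note upper = remaining_moves_upper_bound[OF comp, unfolded list.map sum_list_simps add_0_right upper_weight_def r_eq]
  have "remaining_moves Staller (marks y [n]) = 2 * k + [0, 1, 2, 2, 2] ! r" for y
    using lower[of y] upper[of y] r r_eq(1) by (elim disjE) simp_all
  moreover have "remaining_moves Dominator (marks y [n]) = 2 * k + [0, 1, 1, 1, 1] ! r" for y
    using lower[of y] upper[of y] r r_eq(1) by (elim disjE) simp_all
  ultimately have "game_isolation_number = Suc (2 * k + [0, 1, 2, 2, 2] ! r)"
    "staller_game_isolation_number = Suc (2 * k + [0, 1, 1, 1, 1] ! r)"
    by (intro remaining_moves_first; blast)+
  then show "game_isolation_number = 2 * k + [1, 2, 3, 3, 3] ! r"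
    and "staller_game_isolation_number = 2 * k + [1, 2, 2, 2, 2] ! r"
    using r by auto
qed

end

theorem theorem2p3:
  fixes n :: nat
  assumes "n \<ge> 4"
  shows "int (graph.game_isolation_number (with_proj (cycle_graph n))) =
           (if n mod 5 = 0 then 2 * \<lceil>real n / 5\<rceil> else 2 * \<lceil>real n / 5\<rceil> - 1) \<and>
         int (graph.staller_game_isolation_number (with_proj (cycle_graph n))) =
           (if n mod 5 = 4 then 2 * \<lfloor>real n / 5\<rfloor> + 1 else 2 * \<lfloor>real n / 5\<rfloor>)"
proof -
  interpret cycle_game n using assms by unfold_locales
  define k where "k = (n - 4) div 5"
  define r where "r = (n - 4) mod 5"
  have n: "n = 5 * k + r + 4" and "r < 5"
    using assms by (simp_all add: k_def r_def)
  then have r: "r = 0 \<or> r = 1 \<or> r = 2 \<or> r = 3 \<or> r = 4" by auto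
  have "\<lceil>real n / 5\<rceil> = int k + (if r \<le> 1 then 1 else 2)"
    using r by (intro ceiling_unique) (auto simp: n)
  moreover have "\<lfloor>real n / 5\<rfloor> = int k + (if r = 0 then 0 else 1)"
    using r by (intro floor_unique) (auto simp: n)
  \<comment> \<open>Because of the shift by 4, the exceptional residues 0 and 4 of \<open>n\<close>
    correspond to \<open>r = 1\<close> and \<open>r = 0\<close>.\<close>
  moreover have "n mod 5 = (r + 4) mod 5" unfolding n by presburger
  ultimately show ?thesis
    using r isolation_numbers[OF n \<open>r < 5\<close>] by auto
qed

end
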